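(* Let $n$ and $m$ be nonnegative integers with $m \leq 2^n$, and let $f(n,m)=\sqrt{2^{n+2}m}-m$. Then $\Phi(n,m) \geq f(n,m)$, with equality whenever $f(n,m)$ is an integer. Furthermore, $\Phi(n,m) \leq f(n,m)+\sqrt{2^n}$, and hence $\Phi(n,m) \sim f(n,m)$ as $n \rightarrow \infty$ with $m=\omega(1)$ (that is, for any function $m=m(n)$ with $m(n) \le 2^n$ and $m(n)\to\infty$ as $n\to\infty$, the ratio $\Phi(n,m(n))/f(n,m(n))$ tends to $1$ as $n \to \infty$).
   Context: For a nonnegative integer $n$, $[n]=\{1,\ldots,n\}$ (so $[0]=\emptyset$), and $2^X$ denotes the power set of a set $X$. For a family $\mathcal{F}$ of subsets of $[n]$, let $\mathcal{F}^{\downarrow}=\{S \subseteq [n]: S \subseteq F \text{ for some } F \in \mathcal{F}\}$, $\mathcal{F}^{\uparrow}=\{S \subseteq [n]: F \subseteq S \text{ for some } F \in \mathcal{F}\}$ and $\mathcal{F}^{\updownarrow}=\mathcal{F}^{\uparrow}\cup\mathcal{F}^{\downarrow}$. For nonnegative integers $m,n$ with $m \leq 2^n$, let $\Phi(n,m)=\min\{|\mathcal{F}^{\updownarrow}|: \mathcal{F}\subseteq 2^{[n]},\ |\mathcal{F}|=m\}$. *)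

theory Defs
  imports Complex_Main
begin

definition down_closure :: "nat \<Rightarrow> nat set set \<Rightarrow> nat set set" where
  "down_closure n \<F> = {S. S \<subseteq> {1..n} \<and> (\<exists>F\<in>\<F>. S \<subseteq> F)}"

definition up_closure :: "nat \<Rightarrow> nat set set \<Rightarrow> nat set set" where
  "up_closure n \<F> = {S. S \<subseteq> {1..n} \<and> (\<exists>F\<in>\<F>. F \<subseteq> S)}"

definition updown_closure :: "nat \<Rightarrow> nat set set \<Rightarrow> nat set set" where
  "updown_closure n \<F> = up_closure n \<F> \<union> down_closure n \<F>"

text \<open>The minimum below is over a nonempty finite set precisely when \<open>m \<le> 2 ^ n\<close>;
  otherwise the value of \<open>\<Phi>\<close> is unspecified.\<close>

definition \<Phi> :: "nat \<Rightarrow> nat \<Rightarrow> nat" where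
  "\<Phi> n m = Min {card (updown_closure n \<F>) | \<F>. \<F> \<subseteq> Pow {1..n} \<and> card \<F> = m}"

definition f :: "nat \<Rightarrow> nat \<Rightarrow> real" where
  "f n m = sqrt (2 ^ (n + 2) * real m) - real m"

lemma \<Phi>_attained:
  assumes "m \<le> 2 ^ n"
  obtains \<F> where "\<F> \<subseteq> Pow {1..n}" "card \<F> = m" "\<Phi> n m = card (updown_closure n \<F>)"
proof -
  let ?A = "{card (updown_closure n \<F>) | \<F>. \<F> \<subseteq> Pow {1..n} \<and> card \<F> = m}"
  have "finite ?A"
    by (rule finite_subset[of _ "(\<lambda>\<F>. card (updown_closure n \<F>)) ` Pow (Pow {1..n})"]) auto
  moreover have "\<exists>\<F>. \<F> \<subseteq> Pow {1..n} \<and> card \<F> = m"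
    using assms obtain_subset_with_card_n[of m "Pow {1..n}"] by (metis card_Pow card_atLeastAtMost
      diff_Suc_1 finite_atLeastAtMost)
  ultimately have "\<Phi> n m \<in> ?A"
    unfolding \<Phi>_def by (intro Min_in) auto
  then show thesis using that by auto
qed

lemma \<Phi>_le:
  assumes "\<F> \<subseteq> Pow {1..n}" "card \<F> = m"
  shows "\<Phi> n m \<le> card (updown_closure n \<F>)"
proof -
  let ?A = "{card (updown_closure n \<F>) | \<F>. \<F> \<subseteq> Pow {1..n} \<and> card \<F> = m}"
  have "finite ?A"
    by (rule finite_subset[of _ "(\<lambda>\<F>. card (updown_closure n \<F>)) ` Pow (Pow {1..n})"]) auto
  then show ?thesis
    unfolding \<Phi>_def using assms by (intro Min_le) auto
qed

end

theory Submission
  imports Defs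
begin

text \<open>
  Write \<open>N = 2 ^ n\<close>. The up-closure \<open>\<U>\<close> and the down-closure \<open>\<D>\<close> of a family of \<open>m\<close>
  sets both contain the family, so \<open>i = card (\<U> \<inter> \<D>)\<close> is at least \<open>m\<close>. By the
  Harris--Kleitman inequality (\<open>harris_kleitman\<close>), an up-set and a down-set are negatively
  correlated: \<open>N * i \<le> card \<U> * card \<D>\<close>. With the inequality of the means,
  \<open>card (\<U> \<union> \<D>) \<ge> 2 * sqrt (N * i) - i\<close>, and the right-hand side increases with \<open>i\<close> up to
  \<open>i = N\<close>; at \<open>i = m\<close> it is \<open>f n m\<close>.

  Equality asks for an up-set and a down-set that are independent, of about the same size, and
  meet in about \<open>m\<close> sets. Independence is free if they depend on disjoint blocks of
  coordinates: split \<open>{1..n}\<close> into blocks of \<open>n div 2\<close> and \<open>n - n div 2\<close> elements, take an up-set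
  with \<open>s\<close> members on the first and a down-set with \<open>t\<close> members on the second. Any \<open>m\<close> of
  the \<open>s * t\<close> common members form a family whose closure has at most
  \<open>s * 2 ^ (n - n div 2) + t * 2 ^ (n div 2) - s * t\<close> members (\<open>\<Phi>_le_two_blocks\<close>). Up-sets
  and down-sets exist in every size, so \<open>s\<close> and \<open>t\<close> can be balanced up to rounding, and the
  result is \<open>\<Phi> n m + m \<le> 2 ^ (n div 2) * w\<close> for every natural number \<open>w\<close> with
  \<open>w\<^sup>2 \<ge> 2 ^ (n mod 2 + 2) * m\<close> (\<open>\<Phi>_upper\<close>). Here
  \<open>f n m + m = 2 ^ (n div 2) * sqrt (2 ^ (n mod 2 + 2) * m)\<close>, so that rounding the square root
  up to \<open>w\<close> costs at most \<open>2 ^ (n div 2) \<le> sqrt N\<close>, and nothing if the root is an integer, which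
  holds as soon as \<open>f n m\<close> is one. The asymptotic statement follows because
  \<open>f n m \<ge> sqrt (N * m)\<close>, so the error \<open>sqrt N\<close> is at most \<open>f n m / sqrt m\<close>.
\<close>

section \<open>Up-sets and down-sets\<close>

definition up_set_in :: "'a set \<Rightarrow> 'a set set \<Rightarrow> bool" where
  "up_set_in X \<U> \<longleftrightarrow> \<U> \<subseteq> Pow X \<and> (\<forall>S\<in>\<U>. \<forall>T. S \<subseteq> T \<and> T \<subseteq> X \<longrightarrow> T \<in> \<U>)"

definition down_set_in :: "'a set \<Rightarrow> 'a set set \<Rightarrow> bool" where
  "down_set_in X \<D> \<longleftrightarrow> \<D> \<subseteq> Pow X \<and> (\<forall>S\<in>\<D>. \<forall>T. T \<subseteq> S \<longrightarrow> T \<in> \<D>)"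

text \<open>Adding a minimal non-member to a down-set gives a down-set with one more member.\<close>

lemma down_set_of_card:
  assumes "finite X" and "t \<le> 2 ^ card X"
  obtains \<D> where "down_set_in X \<D>" "card \<D> = t"
proof -
  have "t \<le> 2 ^ card X \<Longrightarrow> \<exists>\<D>. down_set_in X \<D> \<and> card \<D> = t"
  proof (induction t)
    case 0
    then show ?case by (intro exI[of _ "{}"]) (simp add: down_set_in_def)
  next
    case (Suc t)
    then obtain \<D> where D: "down_set_in X \<D>" "card \<D> = t" by auto
    have fin: "finite \<D>"
      using D(1) \<open>finite X\<close> finite_subset[of \<D> "Pow X"] by (simp add: down_set_in_def)
    have "card \<D> < card (Pow X)" using Suc.prems D \<open>finite X\<close> by (simp add: card_Pow)
    then have "Pow X - \<D> \<noteq> {}" using D fin by (metis Diff_eq_empty_iff card_mono leD)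
    then obtain S where S: "S \<in> Pow X - \<D>" and min: "\<forall>T\<in>Pow X - \<D>. T \<subseteq> S \<longrightarrow> S = T"
      using finite_has_minimal[of "Pow X - \<D>"] \<open>finite X\<close> by auto
    have "down_set_in X (insert S \<D>)"
      unfolding down_set_in_def
    proof (intro conjI ballI allI impI)
      fix R T assume R: "R \<in> insert S \<D>" "T \<subseteq> R"
      show "T \<in> insert S \<D>"
      proof (cases "T \<in> \<D>")
        case False
        then have "R = S" using R D(1) by (auto simp: down_set_in_def)
        then have "T \<in> Pow X - \<D>" using R S False by auto
        then show ?thesis using min R \<open>R = S\<close> by auto
      qed simp
    qed (use D(1) S in \<open>auto simp: down_set_in_def\<close>)
    moreover have "card (insert S \<D>) = Suc t" using S fin D by simp
    ultimately show ?case by blast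
  qed
  then show thesis using that assms(2) by blast
qed

lemma up_set_of_card:
  assumes "finite X" and "s \<le> 2 ^ card X"
  obtains \<U> where "up_set_in X \<U>" "card \<U> = s"
proof -
  obtain \<D> where D: "down_set_in X \<D>" "card \<D> = 2 ^ card X - s"
    using down_set_of_card[OF assms(1), of "2 ^ card X - s"] by auto
  have "up_set_in X (Pow X - \<D>)"
    using D(1) unfolding up_set_in_def down_set_in_def by blast
  moreover have "card (Pow X - \<D>) = s"
    using D assms by (simp add: card_Diff_subset finite_subset[of _ "Pow X"] card_Pow down_set_in_def)
  ultimately show thesis using that by blast
qed

section \<open>The Harris--Kleitman inequality\<close>

lemma card_split_at:
  assumes "finite X" "x \<notin> X" "\<A> \<subseteq> Pow (insert x X)"
  shows "card \<A> = card {S \<in> Pow X. S \<in> \<A>} + card {S \<in> Pow X. insert x S \<in> \<A>}"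
proof -
  let ?A0 = "{S \<in> Pow X. S \<in> \<A>}" and ?A1 = "{S \<in> Pow X. insert x S \<in> \<A>}"
  have "\<A> \<subseteq> ?A0 \<union> insert x ` ?A1"
  proof
    fix S assume S: "S \<in> \<A>"
    show "S \<in> ?A0 \<union> insert x ` ?A1"
    proof (cases "x \<in> S")
      case True
      then have "S - {x} \<in> ?A1" "S = insert x (S - {x})"
        using S assms(3) by (auto simp: insert_absorb)
      then show ?thesis by blast
    next
      case False
      then show ?thesis using S assms(3) by auto
    qed
  qed
  then have eq: "\<A> = ?A0 \<union> insert x ` ?A1" by auto
  have "inj_on (insert x) ?A1" using assms(2) by (auto simp: inj_on_def)
  moreover have "?A0 \<inter> insert x ` ?A1 = {}" using assms(2) by auto
  ultimately show ?thesis
    using assms(1) by (subst eq) (simp add: card_Un_disjoint card_image)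
qed

text \<open>
  Induction on the ground set. Split each family according to whether its members contain a
  new point \<open>x\<close>: the sections of the up-set grow and those of the down-set shrink when \<open>x\<close> is
  added, and the induction step is then Chebyshev's inequality for two oppositely ordered pairs.
\<close>

lemma harris_kleitman:
  assumes "finite X" "up_set_in X \<U>" "down_set_in X \<D>"
  shows "2 ^ card X * card (\<U> \<inter> \<D>) \<le> card \<U> * card \<D>"
  using assms
proof (induction X arbitrary: \<U> \<D> rule: finite_induct)
  case empty
  then have "\<U> = {} \<or> \<U> = {{}}" "\<D> = {} \<or> \<D> = {{}}"
    by (auto simp: up_set_in_def down_set_in_def subset_singleton_iff)
  then show ?case by auto
next
  case (insert x X)
  define U0 U1 where "U0 = {S \<in> Pow X. S \<in> \<U>}" and "U1 = {S \<in> Pow X. insert x S \<in> \<U>}"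
  define D0 D1 where "D0 = {S \<in> Pow X. S \<in> \<D>}" and "D1 = {S \<in> Pow X. insert x S \<in> \<D>}"
  have U: "\<U> \<subseteq> Pow (insert x X)" "\<And>S T. S \<in> \<U> \<Longrightarrow> S \<subseteq> T \<Longrightarrow> T \<subseteq> insert x X \<Longrightarrow> T \<in> \<U>"
    using insert.prems(1) by (auto simp: up_set_in_def)
  have D: "\<D> \<subseteq> Pow (insert x X)" "\<And>S T. S \<in> \<D> \<Longrightarrow> T \<subseteq> S \<Longrightarrow> T \<in> \<D>"
    using insert.prems(2) by (auto simp: down_set_in_def)
  have up: "up_set_in X U0" "up_set_in X U1"
    unfolding U0_def U1_def up_set_in_def by (auto intro: U(2))
  have down: "down_set_in X D0" "down_set_in X D1"
    unfolding D0_def D1_def down_set_in_def by (auto intro: D(2))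
  have fin: "finite U1" "finite D0" using insert.hyps(1) by (auto simp: U1_def D0_def)
  have "U0 \<subseteq> U1" unfolding U0_def U1_def by (auto intro: U(2))
  then have u: "card U0 \<le> card U1" using fin card_mono by blast
  have "D1 \<subseteq> D0" unfolding D0_def D1_def by (auto intro: D(2))
  then have d: "card D1 \<le> card D0" using fin card_mono by blast
  have cU: "card \<U> = card U0 + card U1"
    unfolding U0_def U1_def by (rule card_split_at[OF insert.hyps(1,2) U(1)])
  have cD: "card \<D> = card D0 + card D1"
    unfolding D0_def D1_def by (rule card_split_at[OF insert.hyps(1,2) D(1)])
  have "card (\<U> \<inter> \<D>) = card (U0 \<inter> D0) + card (U1 \<inter> D1)"
  proof -
    have "U0 \<inter> D0 = {S \<in> Pow X. S \<in> \<U> \<inter> \<D>}" "U1 \<inter> D1 = {S \<in> Pow X. insert x S \<in> \<U> \<inter> \<D>}"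
      by (auto simp: U0_def U1_def D0_def D1_def)
    then show ?thesis using card_split_at[OF insert.hyps(1,2), of "\<U> \<inter> \<D>"] U(1) by auto
  qed
  then have "2 ^ card (insert x X) * card (\<U> \<inter> \<D>)
      = 2 * (2 ^ card X * card (U0 \<inter> D0) + 2 ^ card X * card (U1 \<inter> D1))"
    using insert.hyps by (simp add: algebra_simps)
  also have "\<dots> \<le> 2 * (card U0 * card D0 + card U1 * card D1)"
    using insert.IH[OF up(1) down(1)] insert.IH[OF up(2) down(2)]
    by (intro mult_le_mono2 add_le_mono)
  also have "\<dots> \<le> (card U0 + card U1) * (card D0 + card D1)"
  proof -
    obtain a where a: "card U1 = card U0 + a" using u le_Suc_ex by blast
    obtain b where b: "card D0 = card D1 + b" using d le_Suc_ex by blast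
    show ?thesis unfolding a b by (simp add: algebra_simps)
  qed
  finally show ?case by (simp add: cU cD)
qed

section \<open>The lower bound\<close>

lemma up_set_up_closure: "up_set_in {1..n} (up_closure n \<F>)"
  unfolding up_set_in_def up_closure_def by blast

lemma down_set_down_closure: "down_set_in {1..n} (down_closure n \<F>)"
  unfolding down_set_in_def down_closure_def by blast

text \<open>
  Of the two steps, the arithmetic-geometric mean inequality gives \<open>2 * sqrt (N * i) \<le> u + d\<close>, and
  replacing \<open>i\<close> by \<open>m\<close> is allowed because \<open>2 * sqrt (N * i) - i = N - (sqrt N - sqrt i)\<^sup>2\<close>
  increases with \<open>i \<le> N\<close>.
\<close>

lemma union_lower_bound:
  fixes u d i m N :: real
  assumes "0 \<le> u" "0 \<le> d" "0 \<le> m" "m \<le> i" "i \<le> N" and corr: "N * i \<le> u * d"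
  shows "2 * sqrt (N * m) - m \<le> u + d - i"
proof -
  define a b c where "a = sqrt m" and "b = sqrt i" and "c = sqrt N"
  have "b ^ 2 = i" "a ^ 2 = m" using assms by (auto simp: a_def b_def)
  have "a \<le> b" "b \<le> c" using assms by (auto simp: a_def b_def c_def)
  then have "0 \<le> (b - a) * (2 * c - b - a)" by simp
  then have "2 * (c * a) - m \<le> 2 * (c * b) - i"
    using \<open>b ^ 2 = i\<close> \<open>a ^ 2 = m\<close> by (simp add: algebra_simps power2_eq_square)
  moreover have "c * b \<le> sqrt (u * d)"
    using corr by (simp add: b_def c_def flip: real_sqrt_mult)
  moreover have "2 * sqrt (u * d) \<le> u + d"
    using arith_geo_mean_sqrt[OF assms(1,2)] by simp
  ultimately show ?thesis by (simp add: a_def c_def real_sqrt_mult)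
qed

lemma f_alt: "f n m = 2 * sqrt (2 ^ n * real m) - real m"
proof -
  have "2 ^ (n + 2) * real m = 2\<^sup>2 * (2 ^ n * real m)" by (simp add: power_add)
  then show ?thesis unfolding f_def by (simp only: real_sqrt_mult[of "2\<^sup>2"]) simp
qed

lemma \<Phi>_lower:
  assumes "m \<le> 2 ^ n"
  shows "f n m \<le> real (\<Phi> n m)"
proof -
  obtain \<F> where F: "\<F> \<subseteq> Pow {1..n}" "card \<F> = m" "\<Phi> n m = card (updown_closure n \<F>)"
    using \<Phi>_attained[OF assms] .
  let ?U = "up_closure n \<F>" and ?D = "down_closure n \<F>"
  have sub: "?U \<subseteq> Pow {1..n}" "?D \<subseteq> Pow {1..n}"
    by (auto simp: up_closure_def down_closure_def)
  then have fin: "finite ?U" "finite ?D" by (auto intro: finite_subset)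
  have "\<F> \<subseteq> ?U \<inter> ?D" using F(1) by (auto simp: up_closure_def down_closure_def)
  then have m: "m \<le> card (?U \<inter> ?D)" using F(2) fin by (metis card_mono finite_Int)
  have "card (?U \<inter> ?D) \<le> card (Pow {1..n})" using sub by (intro card_mono) auto
  then have i: "card (?U \<inter> ?D) \<le> 2 ^ n" by (simp add: card_Pow)
  have hk: "2 ^ n * card (?U \<inter> ?D) \<le> card ?U * card ?D"
    using harris_kleitman[OF _ up_set_up_closure down_set_down_closure, of n \<F> \<F>] by simp
  have "card ?U + card ?D = \<Phi> n m + card (?U \<inter> ?D)"
    using card_Un_Int[OF fin] F(3) by (simp add: updown_closure_def)
  then have "real (card ?U) + real (card ?D) - real (card (?U \<inter> ?D)) = real (\<Phi> n m)"
    by linarith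
  moreover have "2 * sqrt (2 ^ n * real m) - real m
      \<le> real (card ?U) + real (card ?D) - real (card (?U \<inter> ?D))"
  proof (rule union_lower_bound)
    show "real (card (?U \<inter> ?D)) \<le> 2 ^ n"
      using i by (metis of_nat_le_iff of_nat_numeral of_nat_power)
    show "2 ^ n * real (card (?U \<inter> ?D)) \<le> real (card ?U) * real (card ?D)"
      using of_nat_mono[OF hk, where 'a = real] by simp
  qed (use m in auto)
  ultimately show ?thesis by (simp add: f_alt)
qed

section \<open>The construction\<close>

lemma card_two_blocks:
  assumes "P \<inter> Q = {}" "\<A> \<subseteq> Pow P" "\<B> \<subseteq> Pow Q"
  shows "card {S \<in> Pow (P \<union> Q). S \<inter> P \<in> \<A> \<and> S \<inter> Q \<in> \<B>} = card \<A> * card \<B>"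
proof -
  have "bij_betw (\<lambda>(A, B). A \<union> B) (\<A> \<times> \<B>) {S \<in> Pow (P \<union> Q). S \<inter> P \<in> \<A> \<and> S \<inter> Q \<in> \<B>}"
  proof (rule bij_betw_byWitness[where f' = "\<lambda>S. (S \<inter> P, S \<inter> Q)"])
    have parts: "(A \<union> B) \<inter> P = A" "(A \<union> B) \<inter> Q = B" if "A \<in> \<A>" "B \<in> \<B>" for A B
      using that assms by blast+
    show "\<forall>z\<in>\<A> \<times> \<B>. ((case z of (A, B) \<Rightarrow> A \<union> B) \<inter> P, (case z of (A, B) \<Rightarrow> A \<union> B) \<inter> Q) = z"
      using parts by auto
    show "(\<lambda>(A, B). A \<union> B) ` (\<A> \<times> \<B>) \<subseteq> {S \<in> Pow (P \<union> Q). S \<inter> P \<in> \<A> \<and> S \<inter> Q \<in> \<B>}"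
      using parts assms by auto
  qed auto
  then show ?thesis by (simp add: bij_betw_same_card[symmetric] card_cartesian_product)
qed

text \<open>
  Membership in \<open>?U\<close> depends on the first \<open>p\<close> points only and membership in \<open>?D\<close> on the other
  \<open>q\<close>; this makes Harris--Kleitman an equality. Since \<open>?U\<close> and \<open>?D\<close> are already closed, the
  closure of any family of common members stays inside their union.
\<close>

lemma \<Phi>_le_two_blocks:
  assumes "p + q = n" "s \<le> 2 ^ p" "t \<le> 2 ^ q" "m \<le> s * t"
  shows "\<Phi> n m + s * t \<le> s * 2 ^ q + t * 2 ^ p"
proof -
  let ?P = "{1..p}" and ?Q = "{p+1..n}"
  obtain A where A: "up_set_in ?P A" "card A = s"
    using up_set_of_card[of ?P s] assms(2) by (metis card_atLeastAtMost diff_Suc_1 finite_atLeastAtMost)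
  have "card ?Q = q" using assms(1) by simp
  then obtain B where B: "down_set_in ?Q B" "card B = t"
    using down_set_of_card[of ?Q t] assms(3) by (metis finite_atLeastAtMost)
  have A': "A \<subseteq> Pow ?P" and B': "B \<subseteq> Pow ?Q"
    using A B by (auto simp: up_set_in_def down_set_in_def)
  have PQ: "{1..n} = ?P \<union> ?Q" "?P \<inter> ?Q = {}" using assms(1) by auto
  let ?U = "{S \<in> Pow {1..n}. S \<inter> ?P \<in> A}" and ?D = "{S \<in> Pow {1..n}. S \<inter> ?Q \<in> B}"
  have "?U = {S \<in> Pow (?P \<union> ?Q). S \<inter> ?P \<in> A \<and> S \<inter> ?Q \<in> Pow ?Q}" using PQ(1) by auto
  then have cU: "card ?U = s * 2 ^ q"
    using card_two_blocks[OF PQ(2) A' subset_refl] A(2) \<open>card ?Q = q\<close>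
    by (simp only: card_Pow finite_atLeastAtMost)
  have "?D = {S \<in> Pow (?P \<union> ?Q). S \<inter> ?P \<in> Pow ?P \<and> S \<inter> ?Q \<in> B}" using PQ(1) by auto
  then have cD: "card ?D = t * 2 ^ p"
    using card_two_blocks[OF PQ(2) subset_refl B'] B(2) by (simp add: card_Pow)
  have "?U \<inter> ?D = {S \<in> Pow (?P \<union> ?Q). S \<inter> ?P \<in> A \<and> S \<inter> ?Q \<in> B}" using PQ(1) by auto
  then have cUD: "card (?U \<inter> ?D) = s * t"
    using card_two_blocks[OF PQ(2) A' B'] A(2) B(2) by simp
  have "m \<le> card (?U \<inter> ?D)" using cUD assms(4) by simp
  then obtain \<F> where F: "\<F> \<subseteq> ?U \<inter> ?D" "card \<F> = m"
    by (rule obtain_subset_with_card_n)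
  have "up_closure n \<F> \<subseteq> ?U"
  proof
    fix S assume "S \<in> up_closure n \<F>"
    then obtain F where F': "S \<subseteq> {1..n}" "F \<in> \<F>" "F \<subseteq> S"
      unfolding up_closure_def by blast
    have "F \<in> ?U" using F(1) F'(2) by blast
    then have "F \<inter> ?P \<in> A" by simp
    moreover have "F \<inter> ?P \<subseteq> S \<inter> ?P" "S \<inter> ?P \<subseteq> ?P" using F'(3) by blast+
    ultimately have "S \<inter> ?P \<in> A" using A(1) unfolding up_set_in_def by metis
    then show "S \<in> ?U" using F'(1) by simp
  qed
  moreover have "down_closure n \<F> \<subseteq> ?D"
  proof
    fix S assume "S \<in> down_closure n \<F>"
    then obtain F where F': "S \<subseteq> {1..n}" "F \<in> \<F>" "S \<subseteq> F"
      unfolding down_closure_def by blast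
    have "F \<in> ?D" using F(1) F'(2) by blast
    then have "F \<inter> ?Q \<in> B" by simp
    moreover have "S \<inter> ?Q \<subseteq> F \<inter> ?Q" using F'(3) by blast+
    ultimately have "S \<inter> ?Q \<in> B" using B(1) unfolding down_set_in_def by metis
    then show "S \<in> ?D" using F'(1) by simp
  qed
  ultimately have "card (updown_closure n \<F>) \<le> card (?U \<union> ?D)"
    unfolding updown_closure_def by (intro card_mono) auto
  moreover have "\<Phi> n m \<le> card (updown_closure n \<F>)"
    using F by (intro \<Phi>_le) auto
  moreover have "card ?U + card ?D = card (?U \<union> ?D) + card (?U \<inter> ?D)"
    by (intro card_Un_Int) auto
  ultimately show ?thesis using cU cD cUD by linarith
qed

lemma \<Phi>_le_power:
  assumes "m \<le> 2 ^ n"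
  shows "\<Phi> n m \<le> 2 ^ n"
proof -
  obtain \<F> where F: "\<Phi> n m = card (updown_closure n \<F>)"
    using \<Phi>_attained[OF assms] by metis
  have "card (updown_closure n \<F>) \<le> card (Pow {1..n})"
    by (intro card_mono) (auto simp: updown_closure_def up_closure_def down_closure_def)
  then show ?thesis using F by (simp add: card_Pow)
qed

text \<open>
  With blocks of equal size, the closure has at most \<open>2 ^ (n div 2) * (s + t) - s * t\<close> members,
  so a sum \<open>s + t = w\<close> is split as evenly as possible. For odd \<open>n\<close> the second block is larger by one
  point and \<open>2 * s + t\<close> takes the place of \<open>s + t\<close>; the even number \<open>2 * s\<close> should be as
  close to \<open>w / 2\<close> as parity permits. In each residue class of \<open>w\<close> the loss from rounding is
  smaller than one, hence harmless for the integer inequality \<open>m \<le> s * t\<close>.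
\<close>

lemma \<Phi>_upper:
  assumes m: "m \<le> 2 ^ n" and w: "2 ^ (n mod 2 + 2) * m \<le> w\<^sup>2"
  shows "\<Phi> n m + m \<le> 2 ^ (n div 2) * w"
proof (cases "w < 2 ^ (n - n div 2 + 1)")
  case False
  (* The blocks may be too small to have up-sets and down-sets of the sizes that such a large
     w asks for, but then the trivial bounds on both summands suffice. *)
  have "\<Phi> n m + m \<le> 2 ^ (n + 1)" using \<Phi>_le_power[OF m] m by simp
  also have "\<dots> = 2 ^ (n div 2) * 2 ^ (n - n div 2 + 1)" by (simp flip: power_add)
  also have "\<dots> \<le> 2 ^ (n div 2) * w" using False by simp
  finally show ?thesis .
next
  case True
  define k where "k = n div 2"
  show ?thesis
  proof (cases "even n")
    case even: True
    then have n: "n = k + k" by (auto simp: k_def)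
    define s t where "s = w div 2" and "t = (w + 1) div 2"
    have "w = s + t" by (simp add: s_def t_def)
    have "w < 2 * 2 ^ k" using True n by simp
    then have st: "s \<le> 2 ^ k" "t \<le> 2 ^ k" by (simp_all add: s_def t_def)
    have "m \<le> s * t"
    proof -
      have "t = s \<or> t = s + 1" by (auto simp: s_def t_def)
      then show ?thesis
        using w even \<open>w = s + t\<close> by (auto simp: power2_eq_square algebra_simps)
    qed
    then have "\<Phi> n m + m \<le> s * 2 ^ k + t * 2 ^ k"
      using \<Phi>_le_two_blocks[OF n[symmetric] st \<open>m \<le> s * t\<close>] by linarith
    then show ?thesis using \<open>w = s + t\<close> by (simp add: algebra_simps flip: k_def)
  next
    case odd: False
    then have n: "n = k + (k + 1)" by (simp add: k_def) presburger
    (* 2 * s is an even number nearest to w / 2. *)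
    define s t where "s = (w + 1) div 4" and "t = w - 2 * s"
    have "w = 2 * s + t" by (simp add: s_def t_def)
    have "w < 4 * 2 ^ k" using True n by simp
    then have s: "s \<le> 2 ^ k" by (simp add: s_def)
    have "m \<le> s * t" "t \<le> 2 ^ (k + 1)"
    proof -
      have w8: "8 * m \<le> w\<^sup>2" using w odd by (simp add: odd_iff_mod_2_eq_one)
      define j where "j = w div 4"
      consider "w = 4 * j" | "w = 4 * j + 1" | "w = 4 * j + 2" | "w = 4 * j + 3"
        unfolding j_def by linarith
      then have "m \<le> s * t \<and> t \<le> 2 ^ (k + 1)"
      proof cases
        case 1
        then have "s = j" unfolding s_def by linarith
        then have "t = 2 * j" using 1 by (simp add: t_def)
        then show ?thesis using w8 1 \<open>s = j\<close> \<open>w < 4 * 2 ^ k\<close>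
          by (auto simp: power2_eq_square algebra_simps)
      next
        case 2
        then have "s = j" unfolding s_def by linarith
        then have "t = 2 * j + 1" using 2 by (simp add: t_def)
        then show ?thesis using w8 2 \<open>s = j\<close> \<open>w < 4 * 2 ^ k\<close>
          by (auto simp: power2_eq_square algebra_simps)
      next
        case 3
        then have "s = j" unfolding s_def by linarith
        then have "t = 2 * j + 2" using 3 by (simp add: t_def)
        then show ?thesis using w8 3 \<open>s = j\<close> \<open>w < 4 * 2 ^ k\<close>
          by (auto simp: power2_eq_square algebra_simps)
      next
        case 4
        then have "s = j + 1" unfolding s_def by linarith
        then have "t = 2 * j + 1" using 4 by (simp add: t_def)
        then show ?thesis using w8 4 \<open>s = j + 1\<close> \<open>w < 4 * 2 ^ k\<close>
          by (auto simp: power2_eq_square algebra_simps)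
      qed
      then show "m \<le> s * t" "t \<le> 2 ^ (k + 1)" by auto
    qed
    then have "\<Phi> n m + m \<le> s * 2 ^ (k + 1) + t * 2 ^ k"
      using \<Phi>_le_two_blocks[OF n[symmetric] s] by (meson add_left_mono le_trans)
    then show ?thesis using \<open>w = 2 * s + t\<close> by (simp add: algebra_simps flip: k_def)
  qed
qed

section \<open>Rounding and asymptotics\<close>

lemma f_eq_rounding_form:
  "f n m = 2 ^ (n div 2) * sqrt (real (2 ^ (n mod 2 + 2) * m)) - real m"
proof -
  have "n + 2 = 2 * (n div 2) + (n mod 2 + 2)" by simp
  then have "(2::real) ^ (n + 2) = (2 ^ (n div 2))\<^sup>2 * 2 ^ (n mod 2 + 2)"
    by (metis power_add power_mult mult.commute)
  then show ?thesis unfolding f_def by (simp add: real_sqrt_mult)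
qed

lemma \<Phi>_upper_real:
  assumes "m \<le> 2 ^ n" and "sqrt (real (2 ^ (n mod 2 + 2) * m)) \<le> real w"
  shows "real (\<Phi> n m) \<le> 2 ^ (n div 2) * real w - real m"
proof -
  have "real (2 ^ (n mod 2 + 2) * m) \<le> (real w)\<^sup>2"
    using assms(2) by (rule sqrt_le_D)
  then have "2 ^ (n mod 2 + 2) * m \<le> w\<^sup>2"
    by (metis of_nat_le_iff of_nat_power)
  from of_nat_mono[OF \<Phi>_upper[OF assms(1) this], where 'a = real] show ?thesis by simp
qed

lemma \<Phi>_le_f_plus_sqrt:
  assumes "m \<le> 2 ^ n"
  shows "real (\<Phi> n m) \<le> f n m + sqrt (2 ^ n)"
proof -
  define c where "c = real (2 ^ (n mod 2 + 2) * m)"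
  define w where "w = nat \<lceil>sqrt c\<rceil>"
  have "0 \<le> sqrt c" by (simp add: c_def)
  then have w: "sqrt c \<le> real w" "real w \<le> sqrt c + 1" unfolding w_def by linarith+
  have "real (\<Phi> n m) \<le> 2 ^ (n div 2) * real w - real m"
    using \<Phi>_upper_real[OF assms] w(1) by (simp add: c_def)
  also have "\<dots> \<le> 2 ^ (n div 2) * (sqrt c + 1) - real m" using w(2) by simp
  also have "\<dots> = f n m + 2 ^ (n div 2)"
    unfolding f_eq_rounding_form c_def by (simp add: algebra_simps)
  also have "(2::real) ^ (n div 2) \<le> sqrt (2 ^ n)"
    by (rule real_le_rsqrt) (simp add: power_increasing flip: power_mult)
  finally show ?thesis by simp
qed

text \<open>
  If \<open>f n m\<close> is an integer, then \<open>(2 ^ (n div 2))\<^sup>2 * c\<close> is a perfect square, hence so is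
  \<open>c = 2 ^ (n mod 2 + 2) * m\<close>, and nothing is lost by rounding \<open>sqrt c\<close>.
\<close>

lemma \<Phi>_eq_f:
  assumes "m \<le> 2 ^ n" "f n m \<in> \<int>"
  shows "real (\<Phi> n m) = f n m"
proof (rule antisym[OF _ \<Phi>_lower[OF assms(1)]])
  define c where "c = 2 ^ (n mod 2 + 2) * m"
  have f: "f n m = 2 ^ (n div 2) * sqrt (real c) - real m"
    unfolding c_def by (rule f_eq_rounding_form)
  have "f n m + of_nat m \<in> \<int>" using assms(2) by (intro Ints_add Ints_of_nat)
  then have "2 ^ (n div 2) * sqrt (real c) \<in> \<int>" by (simp add: f)
  moreover have "0 \<le> 2 ^ (n div 2) * sqrt (real c)" by simp
  ultimately have "2 ^ (n div 2) * sqrt (real c) \<in> \<nat>" by (simp add: Nats_altdef2)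
  then obtain z where z: "2 ^ (n div 2) * sqrt (real c) = real z" by (auto elim: Nats_cases)
  have "real ((2 ^ (n div 2))\<^sup>2 * c) = real (z\<^sup>2)"
    using arg_cong[OF z, of "\<lambda>x. x\<^sup>2"] by (simp add: power_mult_distrib)
  then have sq: "(2 ^ (n div 2))\<^sup>2 * c = z\<^sup>2" by (simp only: of_nat_eq_iff)
  then have "(2 ^ (n div 2))\<^sup>2 dvd z\<^sup>2" by (metis dvd_triv_left)
  then have "2 ^ (n div 2) dvd z" by simp
  then obtain w where "z = 2 ^ (n div 2) * w" by blast
  then have "sqrt (real c) = real w" using z by simp
  then have "real (\<Phi> n m) \<le> 2 ^ (n div 2) * real w - real m"
    by (intro \<Phi>_upper_real[OF assms(1)]) (simp add: c_def)
  then show "real (\<Phi> n m) \<le> f n m" by (simp add: f \<open>sqrt (real c) = real w\<close>)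
qed

lemma sqrt_le_f:
  assumes "m \<le> 2 ^ n"
  shows "sqrt (2 ^ n * real m) \<le> f n m"
proof -
  have "real m \<le> 2 ^ n" using of_nat_mono[OF assms, where 'a = real] by simp
  then have "(real m)\<^sup>2 \<le> 2 ^ n * real m" by (simp add: power2_eq_square mult_right_mono)
  then have "real m \<le> sqrt (2 ^ n * real m)" by (rule real_le_rsqrt)
  then show ?thesis by (simp add: f_alt)
qed

lemma ratio_bounds:
  assumes "m \<le> 2 ^ n" "0 < m"
  shows "1 \<le> real (\<Phi> n m) / f n m" "real (\<Phi> n m) / f n m \<le> 1 + 1 / sqrt (real m)"
proof -
  have s: "sqrt (2 ^ n) * sqrt (real m) \<le> f n m"
    using sqrt_le_f[OF assms(1)] by (simp add: real_sqrt_mult)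
  have pos: "0 < f n m"
    by (rule less_le_trans[OF _ s]) (use assms in simp)
  then show "1 \<le> real (\<Phi> n m) / f n m" using \<Phi>_lower[OF assms(1)] by simp
  have "sqrt (2 ^ n) \<le> f n m / sqrt (real m)" using s assms by (simp add: field_simps)
  then have "real (\<Phi> n m) \<le> f n m * (1 + 1 / sqrt (real m))"
    using \<Phi>_le_f_plus_sqrt[OF assms(1)] by (simp add: algebra_simps)
  then show "real (\<Phi> n m) / f n m \<le> 1 + 1 / sqrt (real m)"
    using pos by (simp add: field_simps)
qed

lemma \<Phi>_asymp_f:
  fixes m :: "nat \<Rightarrow> nat"
  assumes "\<And>n. m n \<le> 2 ^ n" and lim: "filterlim m at_top sequentially"
  shows "(\<lambda>n. real (\<Phi> n (m n)) / f n (m n)) \<longlonglongrightarrow> 1"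
proof (rule tendsto_sandwich)
  have pos: "\<forall>\<^sub>F n in sequentially. 0 < m n"
    using lim by (simp add: filterlim_at_top Suc_le_eq[symmetric])
  then show "\<forall>\<^sub>F n in sequentially. 1 \<le> real (\<Phi> n (m n)) / f n (m n)"
    by eventually_elim (rule ratio_bounds[OF assms(1)])
  show "\<forall>\<^sub>F n in sequentially.
      real (\<Phi> n (m n)) / f n (m n) \<le> 1 + 1 / sqrt (real (m n))"
    using pos by eventually_elim (rule ratio_bounds[OF assms(1)])
  have "filterlim (\<lambda>n. sqrt (real (m n))) at_top sequentially"
    by (intro filterlim_compose[OF sqrt_at_top] filterlim_compose[OF filterlim_real_sequentially] lim)
  then have "(\<lambda>n. 1 / sqrt (real (m n))) \<longlonglongrightarrow> 0"
    by (intro tendsto_divide_0[OF tendsto_const] filterlim_at_top_imp_at_infinity)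
  then show "(\<lambda>n. 1 + 1 / sqrt (real (m n))) \<longlonglongrightarrow> 1"
    using tendsto_add[OF tendsto_const[of 1]] by fastforce
qed simp

theorem corollary1p2:
  shows "(\<forall>n m :: nat. m \<le> 2 ^ n \<longrightarrow>
            real (\<Phi> n m) \<ge> f n m
          \<and> (f n m \<in> \<int> \<longrightarrow> real (\<Phi> n m) = f n m)
          \<and> real (\<Phi> n m) \<le> f n m + sqrt (2 ^ n))
       \<and> (\<forall>m :: nat \<Rightarrow> nat. (\<forall>n. m n \<le> 2 ^ n) \<longrightarrow> filterlim m at_top sequentially \<longrightarrow>
            (\<lambda>n. real (\<Phi> n (m n)) / f n (m n)) \<longlonglongrightarrow> 1)"
  by (simp add: \<Phi>_lower \<Phi>_eq_f \<Phi>_le_f_plus_sqrt \<Phi>_asymp_f)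

end
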